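(* For every integer $n\ge 4$ there exist an irreducible (entrywise) nonnegative real $n\times n$ matrix $H$ and (entrywise) nonnegative vectors $v,w\in\mathbb{R}^n$ such that, with $A=\rho(H)I_n-H$ and $B(t)=A+tvw^\top$, the number $0$ is an algebraically simple eigenvalue of $A$, the vectors $v$ and $w$ satisfy NZP with respect to $H$, and there is no $t_1>0$ such that for all $t>t_1$ all eigenvalues of $B(t)$ lie in the open right half plane $\{\lambda\in\mathbb{C}:\operatorname{Re}\lambda>0\}$.
   Context: $\rho(H)$ denotes the spectral radius of $H$. NZP (non-zero projection): let $H$ be a nonnegative $n\times n$ matrix such that $\rho(H)$ is a simple eigenvalue of $H$, let $z_r$ be a right unit eigenvector ($Hz_r=\rho(H)z_r$) and $z_l$ a left unit eigenvector ($z_l^\top H=\rho(H)z_l^\top$) of $H$ corresponding to $\rho(H)$; these are unique up to multiplication by $-1$. Vectors $v,w\in\mathbb{R}^n$ satisfy NZP with respect to $H$ if $z_l^\top v\neq 0$ and $w^\top z_r\neq 0$. *)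

theory Defs
  imports "Jordan_Normal_Form.Spectral_Radius"
begin

definition nonneg_vec :: "real vec \<Rightarrow> bool" where
  "nonneg_vec v \<longleftrightarrow> (\<forall>i < dim_vec v. v $ i \<ge> 0)"

definition nonneg_mat :: "real mat \<Rightarrow> bool" where
  "nonneg_mat A \<longleftrightarrow> (\<forall>i < dim_row A. \<forall>j < dim_col A. A $$ (i, j) \<ge> 0)"

text \<open>A square matrix is reducible if simultaneously permuting its rows and columns makes it
  block upper triangular with two nonempty square diagonal blocks, the first of size \<open>k\<close>.
  By this convention every 1 by 1 matrix is irreducible.\<close>

definition reducible_mat :: "real mat \<Rightarrow> bool" where
  "reducible_mat A \<longleftrightarrow>
    (\<exists>p k. p permutes {..<dim_row A} \<and> 0 < k \<and> k < dim_row A \<and>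
      (\<forall>i j. k \<le> i \<and> i < dim_row A \<and> j < k \<longrightarrow> A $$ (p i, p j) = 0))"

definition irreducible_mat :: "real mat \<Rightarrow> bool" where
  "irreducible_mat A \<longleftrightarrow> square_mat A \<and> \<not> reducible_mat A"

definition cmat :: "real mat \<Rightarrow> complex mat" where
  "cmat A = map_mat complex_of_real A"

definition rho :: "real mat \<Rightarrow> real" where
  "rho A = spectral_radius (cmat A)"

definition simple_eigenvalue :: "real mat \<Rightarrow> real \<Rightarrow> bool" where
  "simple_eigenvalue A a \<longleftrightarrow> eigenvalue A a \<and> order a (char_poly A) = 1"

definition unit_vector :: "real vec \<Rightarrow> bool" where
  "unit_vector z \<longleftrightarrow> sqrt (z \<bullet> z) = 1"

definition outer_product :: "real vec \<Rightarrow> real vec \<Rightarrow> real mat" where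
  "outer_product v w = mat (dim_vec v) (dim_vec w) (\<lambda>(i, j). v $ i * w $ j)"

text \<open>The conjuncts before the existential quantifier are the standing assumptions under which NZP makes sense. Under
  them \<open>z\<^sub>r\<close> and \<open>z\<^sub>l\<close> exist and are unique up to sign, so the existential
  quantifier over them is equivalent to a universal one. A left eigenvector of \<open>H\<close> is an
  eigenvector of its transpose.\<close>

definition NZP :: "real mat \<Rightarrow> real vec \<Rightarrow> real vec \<Rightarrow> bool" where
  "NZP H v w \<longleftrightarrow>
    square_mat H \<and> nonneg_mat H \<and> simple_eigenvalue H (rho H) \<and>
    v \<in> carrier_vec (dim_row H) \<and> w \<in> carrier_vec (dim_row H) \<and>
    (\<exists>z\<^sub>r z\<^sub>l.
      eigenvector H z\<^sub>r (rho H) \<and> unit_vector z\<^sub>r \<and>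
      eigenvector (transpose_mat H) z\<^sub>l (rho H) \<and> unit_vector z\<^sub>l \<and>
      z\<^sub>l \<bullet> v \<noteq> 0 \<and> w \<bullet> z\<^sub>r \<noteq> 0)"

end

theory Submission
  imports Defs
begin

text \<open>For the cyclic permutation matrix \<open>H\<close> and \<open>v = e\<^sub>n\<^sub>-\<^sub>1\<close>, \<open>w = e\<^sub>0\<close>, the perturbation
  \<open>t v w\<^sup>T\<close> only changes the weight of the edge closing the cycle from 1 to \<open>1 - t\<close>. Hence the
  eigenvalues of \<open>B(t)\<close> are the numbers \<open>1 - \<mu>\<close> with \<open>\<mu>\<^sup>n = 1 - t\<close>. As \<open>n \<ge> 3\<close>, the root
  \<open>\<mu> = (t - 1)\<^bsup>1/n\<^esup> e\<^bsup>\<pi>\<i>/n\<^esup>\<close> has a positive real part that tends to infinity with \<open>t\<close>.\<close>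

section \<open>Algebraic simplicity from distinct complex roots\<close>

lemma order_le_1_if_distinct_complex_roots:
  fixes p :: "real poly"
  assumes p: "p \<noteq> 0" and deg: "degree p \<le> card S"
    and roots: "\<And>z. z \<in> S \<Longrightarrow> poly (map_poly complex_of_real p) z = 0"
  shows "order a p \<le> 1"
proof (rule ccontr)
  interpret cx: map_poly_comm_ring_hom complex_of_real ..
  assume "\<not> order a p \<le> 1"
  then have "[:- a, 1:] ^ 2 dvd p" by (simp add: order_divides)
  then obtain q where q: "p = [:- a, 1:] ^ 2 * q" ..
  with p have q0: "q \<noteq> 0" by auto
  let ?q = "map_poly complex_of_real q"
  have degp: "degree p = 2 + degree q"
    unfolding q using q0 by (subst degree_mult_eq) (auto simp: degree_power_eq)
  have "map_poly complex_of_real p = map_poly complex_of_real [:- a, 1:] ^ 2 * ?q"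
    unfolding q by (simp only: cx.hom_mult cx.hom_power)
  then have map: "map_poly complex_of_real p = [:- complex_of_real a, 1:] ^ 2 * ?q" by simp
  \<comment> \<open>The squared factor contributes 2 to the degree of \<open>p\<close> but only the
    one point \<open>a\<close> to its root set. So there are at most \<open>1 + degree q\<close>
    distinct roots, one fewer than \<open>degree p\<close>.\<close>
  have "S \<subseteq> insert (complex_of_real a) {z. poly ?q z = 0}"
    using roots unfolding map by auto
  moreover have q0': "?q \<noteq> 0" using q0 by simp
  have fin: "finite {z. poly ?q z = 0}" by (rule poly_roots_finite[OF q0'])
  ultimately have "card S \<le> card (insert (complex_of_real a) {z. poly ?q z = 0})"
    by (intro card_mono) auto
  also have "\<dots> \<le> Suc (card {z. poly ?q z = 0})" using fin
    by (simp add: card_insert_if)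
  also have "\<dots> \<le> Suc (degree q)" using card_poly_roots_bound[OF q0'] by simp
  finally show False using deg degp by simp
qed

text \<open>The characteristic polynomial has degree \<open>n\<close>, so \<open>n\<close> distinct
  roots leave no room for a double one. They are sought over the complex numbers because a real
  matrix may have too few real eigenvalues.\<close>

lemma simple_eigenvalue_if_distinct_complex_eigenvalues:
  assumes A: "A \<in> carrier_mat n n" and a: "eigenvalue A a"
    and S: "card S = n" "\<And>z. z \<in> S \<Longrightarrow> eigenvalue (cmat A) z"
  shows "simple_eigenvalue A a"
proof -
  let ?p = "char_poly A"
  have p: "degree ?p = n" "monic ?p" using degree_monic_char_poly[OF A] by auto
  then have p0: "?p \<noteq> 0" by auto
  have cA: "cmat A \<in> carrier_mat n n" using A by (simp add: cmat_def)
  have "order a ?p \<le> 1"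
  proof (rule order_le_1_if_distinct_complex_roots[OF p0])
    show "degree ?p \<le> card S" using p S by simp
    fix z assume "z \<in> S"
    from S(2)[OF this] have "poly (char_poly (cmat A)) z = 0"
      using eigenvalue_root_char_poly[OF cA] by simp
    then show "poly (map_poly complex_of_real ?p) z = 0"
      by (simp add: cmat_def of_real_hom.char_poly_hom[OF A])
  qed
  moreover have "order a ?p \<noteq> 0"
    using a eigenvalue_root_char_poly[OF A] p0 by (simp add: order_root)
  ultimately show ?thesis using a by (simp add: simple_eigenvalue_def)
qed

section \<open>Eigenvectors and the spectrum of weighted cycle matrices\<close>

lemma eigenvector_smult:
  fixes A :: "'a::field mat"
  assumes A: "A \<in> carrier_mat n n" and x: "eigenvector A x k" and c: "c \<noteq> 0"
  shows "eigenvector A (c \<cdot>\<^sub>v x) k"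
proof -
  have xn: "x \<in> carrier_vec n" and x0: "x \<noteq> 0\<^sub>v n" and e: "A *\<^sub>v x = k \<cdot>\<^sub>v x"
    using x A by (auto simp: eigenvector_def)
  obtain i where i: "i < n" "x $ i \<noteq> 0" using x0 xn by (metis carrier_vecD eq_vecI index_zero_vec)
  then have "(c \<cdot>\<^sub>v x) $ i \<noteq> 0\<^sub>v n $ i" using c xn by auto
  then have "c \<cdot>\<^sub>v x \<noteq> 0\<^sub>v n" by auto
  moreover have "A *\<^sub>v (c \<cdot>\<^sub>v x) = k \<cdot>\<^sub>v (c \<cdot>\<^sub>v x)"
    using mult_mat_vec[OF A xn] e by (simp add: smult_smult_assoc mult.commute)
  ultimately show ?thesis using A xn by (auto simp: eigenvector_def)
qed

lemma eigenvalue_one_minus: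
  fixes A :: "'a::field mat"
  assumes A: "A \<in> carrier_mat n n" and k: "eigenvalue A k"
  shows "eigenvalue (1\<^sub>m n - A) (1 - k)"
proof -
  obtain x where "eigenvector A x k" using k by (auto simp: eigenvalue_def)
  then have x: "x \<in> carrier_vec n" "x \<noteq> 0\<^sub>v n" and e: "A *\<^sub>v x = k \<cdot>\<^sub>v x"
    using A by (auto simp: eigenvector_def)
  have "(1\<^sub>m n - A) *\<^sub>v x = x - k \<cdot>\<^sub>v x"
    using A x e by (simp add: minus_mult_distrib_mat_vec[of _ n n])
  also have "\<dots> = (1 - k) \<cdot>\<^sub>v x" using x by (auto simp: algebra_simps)
  finally show ?thesis using A x unfolding eigenvalue_def eigenvector_def by auto
qed

text \<open>The weighted directed cycle 0, 1, ..., \<open>n - 1\<close>, 0 whose closing edge has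
  weight \<open>c\<close>; equivalently, a companion matrix of X^n - c. The entry type is left open
  so that the real matrix and its complexification share one definition.\<close>

definition cycle_mat :: "nat \<Rightarrow> 'a \<Rightarrow> 'a::comm_ring_1 mat" where
  "cycle_mat n c = mat n n (\<lambda>(i, j). if Suc i = n then (if j = 0 then c else 0)
                                     else if j = Suc i then 1 else 0)"

lemma cycle_mat_carrier [simp]: "cycle_mat n c \<in> carrier_mat n n"
  and dim_cycle_mat [simp]: "dim_row (cycle_mat n c) = n" "dim_col (cycle_mat n c) = n"
  by (auto simp: cycle_mat_def)

lemma cmat_cycle_mat: "cmat (cycle_mat n c) = cycle_mat n (complex_of_real c)"
  by (rule eq_matI) (auto simp: cmat_def cycle_mat_def)

lemma cycle_mat_mult_vec:
  assumes i: "i < n" and x: "x \<in> carrier_vec n"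
  shows "(cycle_mat n c *\<^sub>v x) $ i = (if Suc i = n then c * x $ 0 else x $ Suc i)"
proof -
  have "(cycle_mat n c *\<^sub>v x) $ i = (\<Sum>j\<in>{0..<n}. cycle_mat n c $$ (i, j) * x $ j)"
    using i x by (simp add: scalar_prod_def)
  also have "\<dots> = (\<Sum>j\<in>{0..<n}. if j = (if Suc i = n then 0 else Suc i)
      then (if Suc i = n then c * x $ 0 else x $ Suc i) else 0)"
    using i by (intro sum.cong) (auto simp: cycle_mat_def)
  also have "\<dots> = (if Suc i = n then c * x $ 0 else x $ Suc i)"
    using i by (subst sum.delta) auto
  finally show ?thesis .
qed

lemma eigenvector_cycle_mat:
  assumes n: "n > 0" and k: "k ^ n = c"
  shows "eigenvector (cycle_mat n c) (vec n (\<lambda>i. k ^ i)) k"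
proof -
  let ?x = "vec n (\<lambda>i. k ^ i)"
  \<comment> \<open>Entry 0 is \<open>k ^ 0 = 1\<close>, even for \<open>k = 0\<close>.\<close>
  have "?x $ 0 \<noteq> 0\<^sub>v n $ 0" using n by simp
  then have "?x \<noteq> 0\<^sub>v n" by metis
  moreover have "cycle_mat n c *\<^sub>v ?x = k \<cdot>\<^sub>v ?x"
    using n k by (intro eq_vecI) (auto simp: cycle_mat_mult_vec simp del: index_mult_mat_vec)
  ultimately show ?thesis by (simp add: eigenvector_def)
qed

text \<open>All rows but the last force \<open>x $ i = k ^ i * x $ 0\<close>, so
  \<open>x $ 0\<close> cannot vanish. The last row then reads
  \<open>c * x $ 0 = k ^ n * x $ 0\<close>, where \<open>x $ 0\<close> cancels.\<close>

lemma eigenvalue_cycle_mat_iff: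
  fixes c :: "'a::idom"
  assumes n: "n > 0"
  shows "eigenvalue (cycle_mat n c) k \<longleftrightarrow> k ^ n = c"
proof
  assume "eigenvalue (cycle_mat n c) k"
  then obtain x where x: "x \<in> carrier_vec n" "x \<noteq> 0\<^sub>v n"
    and e: "cycle_mat n c *\<^sub>v x = k \<cdot>\<^sub>v x"
    by (auto simp: eigenvalue_def eigenvector_def)
  have step: "(if Suc i = n then c * x $ 0 else x $ Suc i) = k * x $ i" if "i < n" for i
    using cycle_mat_mult_vec[OF that x(1), of c] that x(1) unfolding e by simp
  have pow: "x $ i = k ^ i * x $ 0" if "i < n" for i
    using that
  proof (induction i)
    case (Suc i)
    then show ?case using step[of i] by (simp add: mult.assoc)
  qed simp
  have x0: "x $ 0 \<noteq> 0"
  proof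
    assume "x $ 0 = 0"
    then have "x = 0\<^sub>v n" using pow x(1) by (intro eq_vecI) auto
    with x(2) show False ..
  qed
  obtain m where m: "n = Suc m" using n by (cases n) auto
  have "c * x $ 0 = k ^ n * x $ 0" using step[of m] pow[of m] m by (simp add: mult.assoc)
  with x0 show "k ^ n = c" by simp
next
  assume "k ^ n = c"
  then show "eigenvalue (cycle_mat n c) k"
    using eigenvector_cycle_mat[OF n] by (auto simp: eigenvalue_def)
qed

text \<open>The complex eigenvalues are the \<open>n\<close>-th roots of unity, all of modulus 1,
  and 1 is among them.\<close>

lemma rho_cycle_mat:
  assumes n: "n > 0"
  shows "rho (cycle_mat n 1) = 1"
proof -
  let ?C = "cycle_mat n (1::complex)"
  have sp: "spectrum ?C = {z. z ^ n = 1}"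
    by (auto simp: spectrum_def eigenvalue_cycle_mat_iff[OF n])
  have norm1: "norm z = 1" if "z ^ n = 1" for z :: complex
    using power_eq_1_iff[OF that] n by simp
  have "norm ` spectrum ?C = {1}"
  proof
    show "norm ` spectrum ?C \<subseteq> {1}" using norm1 by (auto simp: sp)
    have "1 \<in> spectrum ?C" by (simp add: sp)
    then have "norm (1::complex) \<in> norm ` spectrum ?C" by (rule imageI)
    then show "{1} \<subseteq> norm ` spectrum ?C" by simp
  qed
  then show ?thesis by (simp add: rho_def cmat_cycle_mat spectral_radius_def)
qed

text \<open>The \<open>n\<close> distinct complex roots of unity are eigenvalues of the cycle
  matrix, and the injective map \<open>z \<mapsto> 1 - z\<close> carries them to \<open>n\<close>
  distinct eigenvalues of the shifted matrix.\<close>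

lemma simple_eigenvalue_cycle_mat:
  assumes n: "n > 0"
  shows "simple_eigenvalue (cycle_mat n 1) 1"
    and "simple_eigenvalue (1\<^sub>m n - cycle_mat n 1) 0"
proof -
  let ?S = "{z::complex. z ^ n = 1}"
  have S: "card ?S = n" using n by (simp add: card_roots_unity_eq)
  have ev: "eigenvalue (cycle_mat n (1::real)) 1" using n by (simp add: eigenvalue_cycle_mat_iff)
  show "simple_eigenvalue (cycle_mat n 1) 1"
    by (rule simple_eigenvalue_if_distinct_complex_eigenvalues[OF _ ev S])
       (auto simp: cmat_cycle_mat eigenvalue_cycle_mat_iff[OF n])
  have cm: "cmat (1\<^sub>m n - cycle_mat n 1) = 1\<^sub>m n - cycle_mat n 1"
    by (rule eq_matI) (auto simp: cmat_def cycle_mat_def)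
  show "simple_eigenvalue (1\<^sub>m n - cycle_mat n 1) 0"
  proof (rule simple_eigenvalue_if_distinct_complex_eigenvalues)
    show "1\<^sub>m n - cycle_mat n 1 \<in> carrier_mat n n" by auto
    show "eigenvalue (1\<^sub>m n - cycle_mat n 1) (0::real)"
      using eigenvalue_one_minus[OF _ ev] by simp
    show "card ((\<lambda>z. 1 - z) ` ?S) = n" using S by (simp add: card_image inj_on_def)
    show "eigenvalue (cmat (1\<^sub>m n - cycle_mat n 1)) z" if "z \<in> (\<lambda>z. 1 - z) ` ?S" for z
      using that unfolding cm
      by (auto intro!: eigenvalue_one_minus simp: eigenvalue_cycle_mat_iff[OF n])
  qed
qed

section \<open>Irreducibility of the cycle matrix\<close>

lemma irreducible_cycle_mat: "irreducible_mat (cycle_mat n 1)"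
proof -
  have False if p: "p permutes {..<n}" and k: "0 < k" "k < n"
    and z: "\<And>i j. k \<le> i \<Longrightarrow> i < n \<Longrightarrow> j < k \<Longrightarrow> cycle_mat n (1::real) $$ (p i, p j) = 0" for p k
  proof -
    \<comment> \<open>\<open>?T\<close> holds the indices of the second diagonal block. The zero
      block says that no edge leaves \<open>?T\<close>; following the cycle from \<open>p k\<close>
      then puts every index into \<open>?T\<close>, including \<open>p 0\<close>, against
      injectivity of \<open>p\<close>.\<close>
    let ?T = "p ` {k..<n}"
    have succ: "Suc a mod n \<in> ?T" if "a \<in> ?T" for a
    proof (rule ccontr)
      assume not: "Suc a mod n \<notin> ?T"
      have b: "Suc a mod n < n" using k by simp
      then have "Suc a mod n \<in> p ` {..<n}" using permutes_image[OF p] by simp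
      then obtain j where j: "j < n" "Suc a mod n = p j" by auto
      have "j < k"
      proof (rule ccontr)
        assume "\<not> j < k"
        then have "p j \<in> ?T" using j by (intro imageI) simp
        with not j show False by simp
      qed
      moreover obtain i where i: "k \<le> i" "i < n" "a = p i" using \<open>a \<in> ?T\<close> by auto
      \<comment> \<open>This entry is an edge of the cycle, the closing one if
        \<open>Suc a = n\<close>, so its weight is 1.\<close>
      ultimately have "cycle_mat n (1::real) $$ (a, Suc a mod n) = 0" using z j by simp
      moreover have "a < n" using i permutes_in_image[OF p, of i] by simp
      ultimately show False using b by (auto simp: cycle_mat_def split: if_splits)
    qed
    have reach: "(p k + m) mod n \<in> ?T" for m
    proof (induction m)
      case 0
      have "p k < n" using k permutes_in_image[OF p, of k] by simp
      then show ?case using k by simp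
    next
      case (Suc m)
      then show ?case using succ[of "(p k + m) mod n"] by (simp add: mod_Suc_eq)
    qed
    have lt: "p k < n" "p 0 < n" using k permutes_in_image[OF p] by simp_all
    \<comment> \<open>The walk from \<open>p k\<close> goes past the end of the cycle to
      \<open>p 0\<close>; adding \<open>n\<close> avoids truncated subtraction when
      \<open>p 0 < p k\<close>.\<close>
    have "(p k + (n - p k + p 0)) mod n = p 0" using lt by simp
    with reach[of "n - p k + p 0"] have "p 0 \<in> ?T" by simp
    then obtain i where "k \<le> i" "p 0 = p i" by auto
    then show False using k injD[OF permutes_inj[OF p], of 0 i] by simp
  qed
  then show ?thesis unfolding irreducible_mat_def reducible_mat_def by auto
qed

section \<open>Perron vectors and NZP\<close>

lemma eigenvector_cycle_mat_ones:
  fixes n :: nat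
  assumes n: "n > 0"
  shows "eigenvector (cycle_mat n (1::real)) (vec n (\<lambda>_. 1)) 1"
    and "eigenvector (transpose_mat (cycle_mat n (1::real))) (vec n (\<lambda>_. 1)) 1"
proof -
  show "eigenvector (cycle_mat n (1::real)) (vec n (\<lambda>_. 1)) 1"
    using eigenvector_cycle_mat[OF n, of 1 "1::real"] by simp
  let ?x = "vec n (\<lambda>_. 1::real)"
  have "?x $ 0 \<noteq> 0\<^sub>v n $ 0" using n by simp
  then have "?x \<noteq> 0\<^sub>v n" by metis
  moreover have "transpose_mat (cycle_mat n 1) *\<^sub>v ?x = ?x"
  proof (rule eq_vecI)
    fix i assume "i < dim_vec ?x"
    then have i: "i < n" by simp
    have "(transpose_mat (cycle_mat n 1) *\<^sub>v ?x) $ i = (\<Sum>j\<in>{0..<n}. cycle_mat n 1 $$ (j, i))"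
      using i by (simp add: scalar_prod_def)
    \<comment> \<open>Column \<open>i\<close> has a single 1, in the row of the predecessor of
      \<open>i\<close> on the cycle.\<close>
    also have "\<dots> = (\<Sum>j\<in>{0..<n}. if j = (if i = 0 then n - 1 else i - 1) then 1 else 0)"
      using i by (intro sum.cong) (auto simp: cycle_mat_def)
    also have "\<dots> = 1" using i by (subst sum.delta) auto
    finally show "(transpose_mat (cycle_mat n 1) *\<^sub>v ?x) $ i = ?x $ i" using i by simp
  qed simp
  ultimately show "eigenvector (transpose_mat (cycle_mat n (1::real))) ?x 1"
    by (simp add: eigenvector_def)
qed

lemma NZP_cycle_mat:
  assumes n: "n > 0"
  shows "NZP (cycle_mat n 1) (unit_vec n (n - 1)) (unit_vec n 0)"
proof -
  \<comment> \<open>The normalized all-ones vector serves as both left and right eigenvector; each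
    of its entries is \<open>1 / sqrt n\<close>, so it pairs nontrivially with every unit
    vector.\<close>
  let ?z = "(1 / sqrt n) \<cdot>\<^sub>v vec n (\<lambda>_. 1::real)"
  have c: "1 / sqrt n \<noteq> 0" using n by simp
  have unit: "unit_vector ?z"
    using n by (simp add: unit_vector_def scalar_prod_def)
  have "nonneg_mat (cycle_mat n 1)" by (auto simp: nonneg_mat_def cycle_mat_def)
  moreover have "eigenvector (cycle_mat n 1) ?z 1"
    by (rule eigenvector_smult[OF cycle_mat_carrier eigenvector_cycle_mat_ones(1)[OF n] c])
  moreover have "eigenvector (transpose_mat (cycle_mat n 1)) ?z 1"
    by (rule eigenvector_smult[where n = n, OF _ eigenvector_cycle_mat_ones(2)[OF n] c]) simp
  moreover have "?z \<bullet> unit_vec n (n - 1) \<noteq> 0" "unit_vec n 0 \<bullet> ?z \<noteq> 0" using n by auto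
  ultimately show ?thesis
    unfolding NZP_def rho_cycle_mat[OF n] using unit simple_eigenvalue_cycle_mat(1)[OF n]
    by (intro conjI exI[of _ ?z]) simp_all
qed

section \<open>The rank-one perturbation and its instability\<close>

lemma cycle_mat_perturbed:
  assumes n: "n \<ge> 2"
  shows "1 \<cdot>\<^sub>m 1\<^sub>m n - cycle_mat n 1 + t \<cdot>\<^sub>m outer_product (unit_vec n (n - 1)) (unit_vec n 0)
    = 1\<^sub>m n - cycle_mat n (1 - t)"
  using n by (intro eq_matI) (auto simp: cycle_mat_def outer_product_def unit_vec_def)

lemma cycle_mat_perturbed_unstable:
  fixes t\<^sub>1 :: real
  assumes n: "n \<ge> 3" and t1: "t\<^sub>1 > 0"
  obtains t \<mu> where "t > t\<^sub>1" "eigenvalue (cmat (1\<^sub>m n - cycle_mat n (1 - t))) \<mu>" "Re \<mu> \<le> 0"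
proof -
  \<comment> \<open>Since \<open>cis (pi / n) ^ n = -1\<close>, the choice of \<open>t\<close> makes
    \<open>k ^ n = - (s ^ n) = 1 - t\<close>. The summand \<open>t\<^sub>1\<close> in
    \<open>s\<close> gives \<open>t > t\<^sub>1\<close>, and \<open>s \<ge> 2\<close> offsets the
    bound \<open>cos (pi / n) \<ge> 1 / 2\<close>, valid for \<open>n \<ge> 3\<close>, so that
    \<open>Re k \<ge> 1\<close>.\<close>
  define s where "s = 2 + t\<^sub>1"
  define k where "k = of_real s * cis (pi / n)"
  define t where "t = 1 + s ^ n"
  have "s ^ 1 \<le> s ^ n" using n t1 by (intro power_increasing) (auto simp: s_def)
  then have t: "t > t\<^sub>1" by (simp add: t_def s_def)
  have "k ^ n = of_real (s ^ n) * cis (n * (pi / n))"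
    by (simp add: k_def power_mult_distrib DeMoivre)
  also have "\<dots> = complex_of_real (1 - t)" using n by (simp add: t_def)
  finally have "eigenvalue (cycle_mat n (complex_of_real (1 - t))) k"
    using n by (simp add: eigenvalue_cycle_mat_iff)
  then have "eigenvalue (1\<^sub>m n - cycle_mat n (complex_of_real (1 - t))) (1 - k)"
    by (rule eigenvalue_one_minus[OF cycle_mat_carrier])
  moreover have "cmat (1\<^sub>m n - cycle_mat n (1 - t)) = 1\<^sub>m n - cycle_mat n (complex_of_real (1 - t))"
    by (rule eq_matI) (auto simp: cmat_def cycle_mat_def)
  moreover have "Re (1 - k) \<le> 0"
  proof -
    have "cos (pi / 3) \<le> cos (pi / n)"
      using n by (intro cos_monotone_0_pi_le) (auto intro!: divide_left_mono simp: field_simps)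
    then have "1 / 2 \<le> cos (pi / n)" by (simp add: cos_60)
    then have "2 * (1 / 2) \<le> s * cos (pi / n)" using t1 by (intro mult_mono) (auto simp: s_def)
    then show ?thesis by (simp add: k_def)
  qed
  ultimately show thesis using that t by metis
qed

theorem mainTheorem1:
  shows "\<forall>n::nat. n \<ge> 4 \<longrightarrow>
    (\<exists>(H :: real mat) (v :: real vec) (w :: real vec).
      H \<in> carrier_mat n n \<and> v \<in> carrier_vec n \<and> w \<in> carrier_vec n \<and>
      nonneg_mat H \<and> irreducible_mat H \<and> nonneg_vec v \<and> nonneg_vec w \<and>
      (let A = rho H \<cdot>\<^sub>m 1\<^sub>m n - H;
           B = (\<lambda>t::real. A + t \<cdot>\<^sub>m outer_product v w)
       in simple_eigenvalue A 0 \<and>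
          NZP H v w \<and>
          \<not> (\<exists>t\<^sub>1 > 0. \<forall>t > t\<^sub>1. \<forall>\<mu>::complex. eigenvalue (cmat (B t)) \<mu> \<longrightarrow> Re \<mu> > 0)))"
proof (intro allI impI)
  fix n :: nat assume n: "n \<ge> 4"
  let ?H = "cycle_mat n (1::real)"
  let ?v = "unit_vec n (n - 1) :: real vec" and ?w = "unit_vec n 0 :: real vec"
  have n0: "n > 0" using n by simp
  \<comment> \<open>The scalar 1 stands for \<open>rho ?H\<close>, already evaluated; the facts
    below keep it to match the goal once \<open>rho_cycle_mat\<close> has rewritten it.\<close>
  have one: "1 \<cdot>\<^sub>m 1\<^sub>m n = (1\<^sub>m n :: real mat)" by (rule eq_matI) auto
  have "\<not> (\<exists>t\<^sub>1 > 0. \<forall>t > t\<^sub>1. \<forall>\<mu>::complex.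
      eigenvalue (cmat (1 \<cdot>\<^sub>m 1\<^sub>m n - ?H + t \<cdot>\<^sub>m outer_product ?v ?w)) \<mu> \<longrightarrow> Re \<mu> > 0)"
  proof
    assume "\<exists>t\<^sub>1 > 0. \<forall>t > t\<^sub>1. \<forall>\<mu>::complex.
      eigenvalue (cmat (1 \<cdot>\<^sub>m 1\<^sub>m n - ?H + t \<cdot>\<^sub>m outer_product ?v ?w)) \<mu> \<longrightarrow> Re \<mu> > 0"
    then obtain t\<^sub>1 where t1: "t\<^sub>1 > 0" and stable: "\<And>t \<mu>. t > t\<^sub>1 \<Longrightarrow>
        eigenvalue (cmat (1\<^sub>m n - cycle_mat n (1 - t))) \<mu> \<Longrightarrow> Re \<mu> > 0"
      using n by (subst (asm) cycle_mat_perturbed) auto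
    obtain t \<mu> where "t > t\<^sub>1" "eigenvalue (cmat (1\<^sub>m n - cycle_mat n (1 - t))) \<mu>" "Re \<mu> \<le> 0"
      using cycle_mat_perturbed_unstable[of n t\<^sub>1] n t1 by auto
    with stable show False by fastforce
  qed
  moreover have "simple_eigenvalue (1 \<cdot>\<^sub>m 1\<^sub>m n - ?H) 0"
    unfolding one by (rule simple_eigenvalue_cycle_mat(2)[OF n0])
  moreover have "nonneg_mat ?H" using NZP_cycle_mat[OF n0] by (simp add: NZP_def)
  moreover have "nonneg_vec ?v" "nonneg_vec ?w" by (auto simp: nonneg_vec_def unit_vec_def)
  ultimately show "\<exists>(H :: real mat) (v :: real vec) (w :: real vec).
      H \<in> carrier_mat n n \<and> v \<in> carrier_vec n \<and> w \<in> carrier_vec n \<and>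
      nonneg_mat H \<and> irreducible_mat H \<and> nonneg_vec v \<and> nonneg_vec w \<and>
      (let A = rho H \<cdot>\<^sub>m 1\<^sub>m n - H;
           B = (\<lambda>t::real. A + t \<cdot>\<^sub>m outer_product v w)
       in simple_eigenvalue A 0 \<and>
          NZP H v w \<and>
          \<not> (\<exists>t\<^sub>1 > 0. \<forall>t > t\<^sub>1. \<forall>\<mu>::complex. eigenvalue (cmat (B t)) \<mu> \<longrightarrow> Re \<mu> > 0))"
    using irreducible_cycle_mat[of n] NZP_cycle_mat[OF n0]
    by (intro exI[of _ ?H] exI[of _ ?v] exI[of _ ?w]) (auto simp: Let_def rho_cycle_mat[OF n0])
qed

end
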